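(* Let $T$ be a string of length $n \geq 4$ with $\mathsf{e}(T) \geq 3$, and let $b$ be a character with $b \neq T[1]$. Then $\mathsf{e}(b\,T[2..n]) - \mathsf{e}(T) \leq \mathsf{e}(T)$. That is, for $n\ge 4$ and $\mathsf{e}\ge 3$ the worst-case additive sensitivity of the CDAWG size under left-end substitution is at most $\mathsf{e}$.
   Context: Strings are finite sequences of characters from an alphabet $\Sigma$; $\varepsilon$ is the empty string, $T[i]$ is the $i$-th character and $T[i..j]=T[i]\cdots T[j]$. For a string $T$, $\mathrm{Substr}(T)$ is its set of substrings (including $\varepsilon$). A substring $u$ of $T$ is left-maximal in $T$ if $u$ is a prefix of $T$ or there are distinct characters $c \neq d$ with $cu, du \in \mathrm{Substr}(T)$; it is right-maximal in $T$ if $u$ is a suffix of $T$ or there are distinct characters $c\neq d$ with $uc, ud \in \mathrm{Substr}(T)$. $\mathsf{M}(T)$ is the set of substrings of $T$ that are both left- and right-maximal (it contains $\varepsilon$ and $T$). The compact directed acyclic word graph $\mathrm{CDAWG}(T)$ has exactly one node for each element of $\mathsf{M}(T)$, and the outgoing edges of the node $x$ are in bijection with the characters $c$ such that $xc \in \mathrm{Substr}(T)$. For a string $w$, $d_T(w)$ is the number of distinct characters $c$ with $wc \in \mathrm{Substr}(T)$. The size of the CDAWG is $\mathsf{e}(T) = \sum_{x \in \mathsf{M}(T)} d_T(x)$, its number of edges. *)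

theory Defs
  imports "HOL-Library.Sublist"
begin

definition Substr :: "'a list \<Rightarrow> 'a list set" where
  "Substr T = {u. sublist u T}"

definition left_maximal :: "'a list \<Rightarrow> 'a list \<Rightarrow> bool" where
  "left_maximal T u \<longleftrightarrow> u \<in> Substr T \<and>
     (prefix u T \<or> (\<exists>c d. c \<noteq> d \<and> c # u \<in> Substr T \<and> d # u \<in> Substr T))"

definition right_maximal :: "'a list \<Rightarrow> 'a list \<Rightarrow> bool" where
  "right_maximal T u \<longleftrightarrow> u \<in> Substr T \<and>
     (suffix u T \<or> (\<exists>c d. c \<noteq> d \<and> u @ [c] \<in> Substr T \<and> u @ [d] \<in> Substr T))"

definition maximal_substrs :: "'a list \<Rightarrow> 'a list set" where
  "maximal_substrs T = {u \<in> Substr T. left_maximal T u \<and> right_maximal T u}"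

definition right_degree :: "'a list \<Rightarrow> 'a list \<Rightarrow> nat" where
  "right_degree T w = card {c. w @ [c] \<in> Substr T}"

text \<open>The nodes of the CDAWG of \<open>T\<close> are the elements of \<open>maximal_substrs T\<close>, and the node
  \<open>x\<close> has \<open>right_degree T x\<close> outgoing edges, so the following is its number of edges. Both the
  index set and the sets counted by \<open>right_degree\<close> are finite (the latter are subsets of
  \<open>set T\<close>), for an arbitrary alphabet \<open>'a\<close>.\<close>

definition cdawg_size :: "'a list \<Rightarrow> nat" where
  "cdawg_size T = (\<Sum>x\<in>maximal_substrs T. right_degree T x)"

end

theory Submission
  imports Defs
begin

text \<open>
  Write \<open>T = aS\<close> and let \<open>b \<noteq> a\<close>. A node of \<open>bS\<close> with outgoing edges either is not a nonempty
  prefix of \<open>bS\<close> and is already a node of \<open>aS\<close>, or has one of the following two forms.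

  \<^item> A prefix \<open>bv\<close> of \<open>bS\<close> that also occurs in \<open>S\<close>. Then \<open>v\<close> is preceded by both \<open>a\<close> and \<open>b\<close> in
    \<open>aS\<close>, so it is a node of \<open>aS\<close>, and every right extension of \<open>bv\<close> in \<open>bS\<close> is one of \<open>v\<close> in \<open>aS\<close>.
  \<^item> A word \<open>u\<close> that is not left-maximal in \<open>aS\<close>. Then \<open>u\<close> is a prefix of \<open>S\<close> all of whose
    occurrences in \<open>aS\<close> are preceded by \<open>a\<close>, so \<open>au\<close> is a node of \<open>aS\<close> with the same right
    extensions as \<open>u\<close>.

  The maps \<open>bv \<mapsto> v\<close> and \<open>u \<mapsto> au\<close> are injective with disjoint images: \<open>v = au\<close> would make \<open>u\<close> a
  prefix of \<open>v\<close>, so \<open>u\<close> would occur preceded by \<open>b\<close>. Hence the nodes of \<open>aS\<close> are charged at most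
  twice. Only the empty word can gain an edge, namely if \<open>b\<close> does not occur in \<open>S\<close>; but then the
  first form is void and the empty word is charged only once.
\<close>

lemma Substr_Cons: "u \<in> Substr (x # S) \<longleftrightarrow> prefix u (x # S) \<or> u \<in> Substr S"
  by (simp add: Substr_def sublist_Cons_right)

lemma Substr_sublist: "u \<in> Substr S \<Longrightarrow> sublist v u \<Longrightarrow> v \<in> Substr S"
  unfolding Substr_def by (auto intro: sublist_order.order.trans)

lemma prefix_imp_Substr: "prefix u S \<Longrightarrow> u \<in> Substr S"
  by (simp add: Substr_def)

lemma finite_Substr: "finite (Substr S)"
  unfolding Substr_def by (metis set_sublists_eq List.finite_set)

lemma finite_maximal_substrs: "finite (maximal_substrs S)"
  unfolding maximal_substrs_def using finite_Substr[of S] by simp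

lemma finite_right_extensions: "finite {c. w @ [c] \<in> Substr S}"
proof (rule finite_subset)
  show "{c. w @ [c] \<in> Substr S} \<subseteq> set S"
    using set_mono_sublist by (fastforce simp: Substr_def)
qed simp

lemma right_degree_mono:
  assumes "\<And>c. u @ [c] \<in> Substr S \<Longrightarrow> v @ [c] \<in> Substr S'"
  shows "right_degree S u \<le> right_degree S' v"
  unfolding right_degree_def
  by (rule card_mono[OF finite_right_extensions]) (use assms in blast)

lemma right_degree_self: "right_degree S S = 0"
proof -
  have "S @ [c] \<notin> Substr S" for c
    using sublist_length_le[of "S @ [c]" S] by (auto simp: Substr_def)
  then show ?thesis
    by (simp add: right_degree_def)
qed

lemma Nil_maximal: "[] \<in> maximal_substrs S"
  by (simp add: maximal_substrs_def left_maximal_def right_maximal_def Substr_def)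

lemma right_degree_Nil_pos: "0 < right_degree (a # S) []"
proof -
  have "a \<in> {c. [] @ [c] \<in> Substr (a # S)}"
    by (simp add: Substr_Cons)
  then show ?thesis
    unfolding right_degree_def using finite_right_extensions[of "[]"] card_gt_0_iff by blast
qed

text \<open>If \<open>b # v\<close> occurred only at the start of \<open>b # S\<close>, a single
  letter could follow it, and \<open>v \<noteq> S\<close> would keep it from being a suffix.\<close>

lemma proper_prefix_maximal_occurs:
  assumes "b # v \<in> maximal_substrs (b # S)" and "v \<noteq> S" and "prefix v S"
  shows "b # v \<in> Substr S"
proof (rule ccontr)
  assume n: "b # v \<notin> Substr S"
  have nc: "b # v @ [c] \<notin> Substr S" for c
    using n Substr_sublist[of "b # v @ [c]" S "b # v"] by auto
  from assms(1) have "right_maximal (b # S) (b # v)"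
    by (simp add: maximal_substrs_def)
  moreover have "\<not> suffix (b # v) (b # S)"
    using n assms(2) by (auto simp: suffix_Cons Substr_def)
  ultimately obtain c d where "c \<noteq> d" "prefix (v @ [c]) S" "prefix (v @ [d]) S"
    using nc by (auto simp: right_maximal_def Substr_Cons)
  then show False
    by (auto simp: prefix_def)
qed

lemma tail_of_recurrent_prefix_maximal:
  assumes "b # v \<in> maximal_substrs (b # S)" and "b # v \<in> Substr S" and "prefix v S" and "a \<noteq> b"
  shows "v \<in> maximal_substrs (a # S)"
    and "right_degree (b # S) (b # v) \<le> right_degree (a # S) v"
proof -
  have ext: "v @ [c] \<in> Substr (a # S)" if "b # v @ [c] \<in> Substr (b # S)" for c
    using that Substr_sublist[of "b # v @ [c]" S "v @ [c]"]
    by (auto simp: Substr_Cons sublist_Cons_right prefix_imp_Substr)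
  then show "right_degree (b # S) (b # v) \<le> right_degree (a # S) v"
    by (intro right_degree_mono) simp
  have v: "v \<in> Substr (a # S)"
    using assms(3) by (simp add: Substr_Cons prefix_imp_Substr)
  have "a # v \<in> Substr (a # S)" "b # v \<in> Substr (a # S)"
    using assms by (simp_all add: Substr_Cons)
  then have "left_maximal (a # S) v"
    using v assms(4) unfolding left_maximal_def by blast
  moreover have "right_maximal (b # S) (b # v)"
    using assms(1) by (simp add: maximal_substrs_def)
  then have "right_maximal (a # S) v"
    using ext v unfolding right_maximal_def
    by (auto simp: suffix_Cons dest: suffix_ConsD)
  ultimately show "v \<in> maximal_substrs (a # S)"
    using v by (simp add: maximal_substrs_def)
qed

text \<open>As \<open>u\<close> is no prefix of \<open>b # S\<close>, it and all its right
  extensions occur inside \<open>S\<close>. So right-maximality survives the substitution, and only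
  left-maximality can fail in \<open>a # S\<close>.\<close>

lemma maximal_after_substitution_only:
  assumes "u \<in> maximal_substrs (b # S)" and "\<not> prefix u (b # S)"
    and "u \<notin> maximal_substrs (a # S)"
  shows "prefix u S"
    and "\<And>x. x # u \<in> Substr (a # S) \<Longrightarrow> x = a"
    and "a # u \<in> maximal_substrs (a # S)"
    and "right_degree (b # S) u \<le> right_degree (a # S) (a # u)"
proof -
  have uS: "u \<in> Substr S"
    using assms(1,2) by (auto simp: maximal_substrs_def Substr_Cons)
  then have uaS: "u \<in> Substr (a # S)"
    by (simp add: Substr_Cons)
  have ext: "u @ [c] \<in> Substr S" if "u @ [c] \<in> Substr (b # S)" for c
    using that assms(2) append_prefixD by (auto simp: Substr_Cons)
  have suf: "suffix u S" if "suffix u (b # S)"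
    using that assms(2) by (auto simp: suffix_Cons)
  have rm: "right_maximal (b # S) u" and lm: "left_maximal (b # S) u"
    using assms(1) by (simp_all add: maximal_substrs_def)
  have "right_maximal (a # S) u"
    using rm ext suf uaS unfolding right_maximal_def by (auto simp: suffix_Cons Substr_Cons)
  then have nlm: "\<not> left_maximal (a # S) u"
    using assms(3) uaS by (simp add: maximal_substrs_def)
  then have npre: "\<not> prefix u (a # S)"
    using uaS by (simp add: left_maximal_def)
  show pre: "prefix u S"
  proof (rule ccontr)
    assume n: "\<not> prefix u S"
    \<comment> \<open>Prepending \<open>b\<close> to \<open>S\<close> creates no occurrence of a
      word \<open>x # u\<close> unless \<open>u\<close> is a prefix of \<open>S\<close>, so both
      left extensions already lie in \<open>S\<close>.\<close>
    obtain c d where "c \<noteq> d" "c # u \<in> Substr (b # S)" "d # u \<in> Substr (b # S)"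
      using lm assms(2) unfolding left_maximal_def by blast
    then have "c # u \<in> Substr (a # S)" "d # u \<in> Substr (a # S)"
      using n by (auto simp: Substr_Cons)
    then show False
      using nlm uaS \<open>c \<noteq> d\<close> unfolding left_maximal_def by blast
  qed
  then have au: "a # u \<in> Substr (a # S)"
    by (simp add: Substr_Cons)
  show only: "x = a" if "x # u \<in> Substr (a # S)" for x
    using nlm uaS au that unfolding left_maximal_def by blast
  \<comment> \<open>Since \<open>u\<close> is no prefix of \<open>a # S\<close>, some letter
    precedes each occurrence, and \<open>only\<close> forces it to be \<open>a\<close>. The suffix
    case below uses the same argument.\<close>
  have aext: "a # u @ [c] \<in> Substr (a # S)" if "u @ [c] \<in> Substr (b # S)" for c
  proof -
    have "u @ [c] \<in> Substr (a # S)"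
      using ext[OF that] by (simp add: Substr_Cons)
    then obtain p q where pq: "a # S = p @ (u @ [c]) @ q"
      unfolding Substr_def sublist_def by blast
    have "p \<noteq> []"
      using npre pq by (auto simp: prefix_def)
    then obtain p' x where p: "p = p' @ [x]"
      by (metis rev_exhaust)
    then have "x # u @ [c] \<in> Substr (a # S)"
      using pq by (auto simp: Substr_def sublist_def)
    moreover from this have "x # u \<in> Substr (a # S)"
      using Substr_sublist[of "x # u @ [c]" _ "x # u"] by auto
    ultimately show ?thesis
      using only by blast
  qed
  then show "right_degree (b # S) u \<le> right_degree (a # S) (a # u)"
    by (intro right_degree_mono) simp
  have "suffix (a # u) (a # S)" if "suffix u (b # S)"
  proof -
    obtain p where p: "a # S = p @ u"
      using suffix_ConsI[OF suf] \<open>suffix u (b # S)\<close> by (metis suffix_def)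
    then have "p \<noteq> []"
      using npre by auto
    then obtain p' x where p': "p = p' @ [x]"
      by (metis rev_exhaust)
    then have "suffix (x # u) (a # S)"
      using p by (simp add: suffix_def)
    moreover from this have "x = a"
      using only by (simp add: Substr_def)
    ultimately show ?thesis by simp
  qed
  then have "right_maximal (a # S) (a # u)"
    using rm au aext unfolding right_maximal_def by auto
  then show "a # u \<in> maximal_substrs (a # S)"
    using au pre by (simp add: maximal_substrs_def left_maximal_def)
qed

lemma cdawg_size_subst_hd:
  assumes "a \<noteq> b"
  shows "cdawg_size (b # S) \<le> 2 * cdawg_size (a # S)"
proof -
  let ?A = "maximal_substrs (a # S)" and ?B = "maximal_substrs (b # S)"
  let ?da = "right_degree (a # S)" and ?db = "right_degree (b # S)"
  \<comment> \<open>The condition \<open>v \<noteq> S\<close> leaves out the node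
    \<open>b # S\<close>, which cannot recur in \<open>S\<close> but has no outgoing edges.\<close>
  define V where "V = {v. b # v \<in> ?B \<and> prefix v S \<and> v \<noteq> S}"
  define C where "C = {u \<in> ?B. \<not> prefix u (b # S) \<and> u \<notin> ?A}"
  \<comment> \<open>The empty word, a prefix of \<open>b # S\<close>, lies outside \<open>K\<close>
    and is handled separately because its degree may grow.\<close>
  define K where "K = {u \<in> ?B. \<not> prefix u (b # S) \<and> u \<in> ?A}"
  define \<delta> where "\<delta> = (if [b] \<in> Substr S then 0 else 1 :: nat)"
  have fin: "finite ?A" "finite ?B"
    by (rule finite_maximal_substrs)+
  have finC: "finite C" and finK: "finite K"
    using fin by (auto simp: C_def K_def)
  have "V \<subseteq> tl ` ?B"
    by (force simp: V_def)
  then have finV: "finite V"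
    using fin finite_subset by blast
  have recurs: "b # v \<in> Substr S" if "v \<in> V" for v
    using that proper_prefix_maximal_occurs by (auto simp: V_def)
  have V: "v \<in> ?A" "?db (b # v) \<le> ?da v" if "v \<in> V" for v
    using that recurs tail_of_recurrent_prefix_maximal[of b v S a] assms by (auto simp: V_def)
  have C: "prefix u S" "b # u \<notin> Substr (a # S)" "a # u \<in> ?A" "?db u \<le> ?da (a # u)" if "u \<in> C" for u
    using that maximal_after_substitution_only[of u b S a] assms unfolding C_def by blast+
  have disj: "V \<inter> (#) a ` C = {}"
  proof (rule ccontr)
    assume "V \<inter> (#) a ` C \<noteq> {}"
    then obtain u where u: "a # u \<in> V" "u \<in> C"
      by blast
    then have "prefix u (a # u)"
      using C(1) prefix_length_prefix[of u S "a # u"] by (auto simp: V_def)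
    then have "b # u \<in> Substr S"
      using recurs[OF u(1)] Substr_sublist[of "b # a # u" S "b # u"] by (simp add: prefix_imp_sublist)
    then show False
      using C(2)[OF u(2)] by (simp add: Substr_Cons)
  qed
  have Kdeg: "?db u \<le> ?da u" if "u \<in> K" for u
  proof (rule right_degree_mono)
    fix c assume "u @ [c] \<in> Substr (b # S)"
    then show "u @ [c] \<in> Substr (a # S)"
      using that append_prefixD unfolding K_def by (auto simp: Substr_Cons)
  qed
  have "{c. [] @ [c] \<in> Substr (b # S)}
      \<subseteq> {c. [] @ [c] \<in> Substr (a # S)} \<union> (if [b] \<in> Substr S then {} else {b})"
    by (auto simp: Substr_Cons)
  then have "?db [] \<le> card ({c. [] @ [c] \<in> Substr (a # S)} \<union> (if [b] \<in> Substr S then {} else {b}))"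
    unfolding right_degree_def by (intro card_mono finite_UnI finite_right_extensions) auto
  also have "\<dots> \<le> ?da [] + \<delta>"
    unfolding right_degree_def \<delta>_def by (rule order_trans[OF card_Un_le]) simp
  finally have dNil: "?db [] \<le> ?da [] + \<delta>" .

  have NilK: "[] \<notin> K"
    by (simp add: K_def)
  have "sum ?db (insert [] K) \<le> ?da [] + \<delta> + sum ?da K"
    unfolding sum.insert[OF finK NilK] by (intro add_mono dNil sum_mono Kdeg)
  also have "\<dots> = sum ?da (insert [] K) + \<delta>"
    using finK NilK by simp
  also have "\<dots> \<le> cdawg_size (a # S) + \<delta>"
    unfolding cdawg_size_def using Nil_maximal
    by (auto intro!: sum_mono2 fin simp: K_def)
  finally have sumK: "sum ?db (insert [] K) \<le> cdawg_size (a # S) + \<delta>" .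

  have "sum ?db ((#) b ` V) + sum ?db C = (\<Sum>v\<in>V. ?db (b # v)) + sum ?db C"
    by (simp add: sum.reindex)
  also have "\<dots> \<le> sum ?da V + (\<Sum>u\<in>C. ?da (a # u))"
    by (intro add_mono sum_mono V C)
  also have "\<dots> = sum ?da (V \<union> (#) a ` C)"
    using disj finV finC by (simp add: sum.union_disjoint sum.reindex)
  \<comment> \<open>The possible extra edge \<delta> from \<open>sumK\<close> is paid for here, so
    that each of the two estimates stays within one copy of
    \<open>cdawg_size (a # S)\<close>.\<close>
  finally have "sum ?db ((#) b ` V) + sum ?db C + \<delta> \<le> sum ?da (V \<union> (#) a ` C) + \<delta>"
    by simp
  also have "\<dots> \<le> cdawg_size (a # S)"
  proof (cases "[b] \<in> Substr S")
    case True
    then show ?thesis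
      unfolding cdawg_size_def using V C by (auto intro!: sum_mono2 fin simp: \<delta>_def)
  next
    case False
    \<comment> \<open>Every charged word now starts with \<open>a\<close>, so the empty word, with
      at least one outgoing edge, is free to absorb \<delta>.\<close>
    have "V = {}"
      using False recurs Substr_sublist[of "b # _" S "[b]"] by fastforce
    then have "sum ?da (V \<union> (#) a ` C) \<le> sum ?da (?A - {[]})"
      using C by (auto intro!: sum_mono2 simp: fin)
    moreover have "cdawg_size (a # S) = ?da [] + sum ?da (?A - {[]})"
      unfolding cdawg_size_def by (rule sum.remove[OF fin(1) Nil_maximal])
    ultimately show ?thesis
      using right_degree_Nil_pos[of a S] by (simp add: \<delta>_def)
  qed
  finally have sumVC: "sum ?db ((#) b ` V) + sum ?db C + \<delta> \<le> cdawg_size (a # S)" .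

  have Un: "sum ?db (X \<union> Y) \<le> sum ?db X + sum ?db Y" if "finite X" "finite Y" for X Y
    using sum.union_inter[OF that, of ?db] by linarith
  \<comment> \<open>A prefix of \<open>b # S\<close> is empty or \<open>b # v\<close> with
    \<open>v\<close> a prefix of \<open>S\<close>, so the pieces cover all nodes; an upper bound
    does not need them disjoint.\<close>
  have "?B \<subseteq> {b # S} \<union> (insert [] K \<union> ((#) b ` V \<union> C))"
    by (auto simp: V_def C_def K_def prefix_Cons)
  then have "cdawg_size (b # S) \<le> sum ?db ({b # S} \<union> (insert [] K \<union> ((#) b ` V \<union> C)))"
    unfolding cdawg_size_def using finV finC finK by (intro sum_mono2) auto
  also have "\<dots> \<le> sum ?db {b # S} + (sum ?db (insert [] K) + (sum ?db ((#) b ` V) + sum ?db C))"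
    using finV finC finK by (intro order_trans[OF Un] add_mono order_refl) auto
  also have "\<dots> \<le> 2 * cdawg_size (a # S)"
    using sumK sumVC by (simp add: right_degree_self)
  finally show ?thesis .
qed

theorem theorem5:
  fixes T :: "'a list" and b :: 'a
  assumes "length T \<ge> 4"
    and "cdawg_size T \<ge> 3"
    and "b \<noteq> hd T"
  shows "int (cdawg_size (b # tl T)) - int (cdawg_size T) \<le> int (cdawg_size T)"
proof -
  obtain a S where "T = a # S"
    using assms(1) by (cases T) auto
  then show ?thesis
    using cdawg_size_subst_hd[of a b S] assms(3) by auto
qed

end
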